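(* $\mathrm{GST}_n$ is disconnected for $n=3,4$, and $\mathrm{GST}_n$ is connected for every integer $n\ge 8$.
   Context: For $n\ge 2$ and $\mathbf p=(p_1,\dots,p_n)\in\mathbb R^n$ let $$\psi(\mathbf p)=\bigg(\frac{1}{2^{n-1}}\sum_{k=0}^{n-1}\binom{n-1}{k}p_{k+1}\bigg)^2-\frac{1}{2^{n-1}}\sum_{k=0}^{n-2}\binom{n-2}{k}\big(p_{k+2}^2+p_{k+1}p_{n-(k+1)}\big).$$ Put $\mathrm{Ind}_n=\{\mathbf p\in[0,1]^n:\psi(\mathbf p)=0\}$. For $x\in\{0,1\}^n$ and $1\le i\le n$ put $\pi_i(x)=p_k$ with $k=\#\{j: x_j=x_i\}$. $\mathrm{Inf}_n$ is the set of $\mathbf p\in[0,1]^n$ such that for all $1\le i,j\le n$ there is $x\in\{0,1\}^n$ with $\pi_i(x)\neq\pi_i(x')$, where $x'$ is $x$ with its $j$-th coordinate flipped. $\mathrm{GST}_n=\mathrm{Ind}_n\cap\mathrm{Inf}_n$, with the subspace topology from $\mathbb R^n$. *)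

theory Defs
  imports "HOL-Analysis.Analysis"
begin

text \<open>
  Points of $\mathbb{R}^n$ are the functions in \<^term>\<open>{1..n} \<rightarrow>\<^sub>E (UNIV :: real set)\<close>, so that the
  coordinate $p_i$ is \<^term>\<open>p i\<close> for $1 \le i \le n$ and there is exactly one function per point;
  \<^term>\<open>powertop_real {1..n}\<close> is the usual topology on them.  All definitions are meant for $n \ge 2$.
\<close>

definition psi :: "nat \<Rightarrow> (nat \<Rightarrow> real) \<Rightarrow> real" where
  "psi n p =
     (1 / 2 ^ (n - 1) * (\<Sum>k = 0..n - 1. real ((n - 1) choose k) * p (k + 1)))\<^sup>2
     - 1 / 2 ^ (n - 1) *
         (\<Sum>k = 0..n - 2. real ((n - 2) choose k) * ((p (k + 2))\<^sup>2 + p (k + 1) * p (n - (k + 1))))"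

definition Ind :: "nat \<Rightarrow> (nat \<Rightarrow> real) set" where
  "Ind n = {p \<in> {1..n} \<rightarrow>\<^sub>E {0..1}. psi n p = 0}"

definition bitvecs :: "nat \<Rightarrow> (nat \<Rightarrow> nat) set" where
  "bitvecs n = {1..n} \<rightarrow>\<^sub>E {0, 1}"

definition flip :: "nat \<Rightarrow> (nat \<Rightarrow> nat) \<Rightarrow> nat \<Rightarrow> nat" where
  "flip j x = x(j := 1 - x j)"

definition prob_at :: "nat \<Rightarrow> (nat \<Rightarrow> real) \<Rightarrow> nat \<Rightarrow> (nat \<Rightarrow> nat) \<Rightarrow> real" where
  "prob_at n p i x = p (card {j \<in> {1..n}. x j = x i})"

definition Inf_set :: "nat \<Rightarrow> (nat \<Rightarrow> real) set" where
  "Inf_set n = {p \<in> {1..n} \<rightarrow>\<^sub>E {0..1}.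
     \<forall>i\<in>{1..n}. \<forall>j\<in>{1..n}. \<exists>x\<in>bitvecs n. prob_at n p i x \<noteq> prob_at n p i (flip j x)}"

definition GST :: "nat \<Rightarrow> (nat \<Rightarrow> real) set" where
  "GST n = Ind n \<inter> Inf_set n"

definition GST_topology :: "nat \<Rightarrow> (nat \<Rightarrow> real) topology" where
  "GST_topology n = subtopology (powertop_real {1..n}) (GST n)"

end

theory Submission
  imports Defs
begin

text \<open>
  The set \<open>Inf\<^sub>n\<close> consists of the points that differ from their reversal, and \<open>psi\<close> is a quadratic
  form with the constants in its kernel, nonpositive on symmetric points. For \<open>n = 3, 4\<close> a linear
  form without zeros on \<open>GST\<^sub>n\<close> takes both signs there. For \<open>n \<ge> 8\<close> the form is positive on the
  plane spanned by \<open>e\<^sub>1\<close> and \<open>(n - 2) e\<^sub>2 - e\<^bsub>n-2\<^esub>\<close>, so the asymmetric points with \<open>psi \<ge> 0\<close> form a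
  connected set. Pushing it in the directions \<open>h\<close> and \<open>-h\<close>, where \<open>h\<close> is symmetric with
  \<open>psi h < 0\<close>, covers the cone of asymmetric zeros by two connected sets, which meet in a zero
  orthogonal to \<open>h\<close>. Scaling about the centre of the cube carries this cone onto \<open>GST\<^sub>n\<close>.
\<close>

section \<open>The quadratic form\<close>

text \<open>The expectation of \<open>p (1 + K)\<close> for \<open>K\<close> binomial with
  parameters \<open>n - 1\<close> and 1/2.\<close>

definition binom_mean :: "nat \<Rightarrow> (nat \<Rightarrow> real) \<Rightarrow> real" where
  "binom_mean n p = 1 / 2 ^ (n - 1) * (\<Sum>k = 0..n - 1. real ((n - 1) choose k) * p (k + 1))"

text \<open>The product of coordinates \<open>k + 1\<close> and \<open>n - (k + 1)\<close> is
  symmetrised, so this is the symmetric bilinear form with diagonal \<open>psi\<close>.\<close>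

definition psi_polar :: "nat \<Rightarrow> (nat \<Rightarrow> real) \<Rightarrow> (nat \<Rightarrow> real) \<Rightarrow> real" where
  "psi_polar n p q = binom_mean n p * binom_mean n q
     - 1 / 2 ^ (n - 1) * (\<Sum>k = 0..n - 2. real ((n - 2) choose k) *
         (p (k + 2) * q (k + 2) + (p (k + 1) * q (n - (k + 1)) + q (k + 1) * p (n - (k + 1))) / 2))"

definition nonsym :: "nat \<Rightarrow> (nat \<Rightarrow> real) \<Rightarrow> bool" where
  "nonsym n p \<longleftrightarrow> (\<exists>k\<in>{1..n}. p k \<noteq> p (n + 1 - k))"

lemma psi_eq_polar: "psi n p = psi_polar n p p"
  by (simp add: psi_def psi_polar_def binom_mean_def power2_eq_square)

lemma psi_polar_sym: "psi_polar n p q = psi_polar n q p"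
  by (simp add: psi_polar_def mult.commute add.commute)

lemma binom_mean_lin:
  "binom_mean n (\<lambda>i. a * p i + b * q i) = a * binom_mean n p + b * binom_mean n q"
  by (simp add: binom_mean_def algebra_simps sum.distrib sum_distrib_left)

lemma psi_polar_lin:
  "psi_polar n (\<lambda>i. a * p i + b * q i) r = a * psi_polar n p r + b * psi_polar n q r"
proof -
  define w where "w p k = real ((n - 2) choose k) *
         (p (k + 2) * r (k + 2) + (p (k + 1) * r (n - (k + 1)) + r (k + 1) * p (n - (k + 1))) / 2)"
    for p :: "nat \<Rightarrow> real" and k
  have "w (\<lambda>i. a * p i + b * q i) k = a * w p k + b * w q k" for k
    by (simp add: w_def field_simps)
  then have "(\<Sum>k=0..n-2. w (\<lambda>i. a * p i + b * q i) k)
      = a * (\<Sum>k=0..n-2. w p k) + b * (\<Sum>k=0..n-2. w q k)"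
    by (simp add: sum.distrib sum_distrib_left)
  then show ?thesis
    unfolding psi_polar_def binom_mean_lin w_def by (simp add: algebra_simps add_divide_distrib)
qed

lemma psi_comb:
  "psi n (\<lambda>i. a * p i + b * q i) = a\<^sup>2 * psi n p + 2 * a * b * psi_polar n p q + b\<^sup>2 * psi n q"
  unfolding psi_eq_polar
  using psi_polar_lin[of n a p b q "\<lambda>i. a * p i + b * q i"]
    psi_polar_lin[of n a p b q p] psi_polar_lin[of n a p b q q]
    psi_polar_sym[of n p "\<lambda>i. a * p i + b * q i"] psi_polar_sym[of n q "\<lambda>i. a * p i + b * q i"]
    psi_polar_sym[of n p q]
  by (simp add: power2_eq_square algebra_simps)

lemma binomial_sum_reflect:
  fixes f :: "nat \<Rightarrow> real"
  shows "(\<Sum>k=0..m. real (m choose k) * f (m - k)) = (\<Sum>k=0..m. real (m choose k) * f k)"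
proof -
  have "(\<Sum>k=0..m. real (m choose k) * f k) = (\<Sum>k=0..m. real (m choose (m - k)) * f (m - k))"
    by (subst sum.atLeastAtMost_rev) simp
  then show ?thesis
    by (simp flip: binomial_symmetric cong: sum.cong_simp)
qed

lemma binomial_sum_pascal:
  fixes f :: "nat \<Rightarrow> real"
  shows "(\<Sum>k=0..Suc m. real (Suc m choose k) * f k) = (\<Sum>k=0..m. real (m choose k) * (f k + f (Suc k)))"
proof -
  have 1: "(\<Sum>k=0..Suc m. real (Suc m choose k) * f k)
      = f 0 + (\<Sum>k=0..m. real (m choose k) * f (Suc k)) + (\<Sum>k=0..m. real (m choose Suc k) * f (Suc k))"
    by (subst sum.atLeast0_atMost_Suc_shift) (simp add: algebra_simps sum.distrib)
  have "f 0 + (\<Sum>k=0..m. real (m choose Suc k) * f (Suc k)) = (\<Sum>k=0..Suc m. real (m choose k) * f k)"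
    by (subst sum.atLeast0_atMost_Suc_shift) simp
  also have "\<dots> = (\<Sum>k=0..m. real (m choose k) * f k)"
    by simp
  finally show ?thesis
    using 1 by (simp add: algebra_simps sum.distrib)
qed

text \<open>Pascal's rule moves the mean to row \<open>n - 2\<close>, the row of the second sum of
  \<open>psi\<close>, so that the two can be compared term by term.\<close>

lemma binom_mean_pascal:
  assumes "2 \<le> n"
  shows "binom_mean n p = 1 / 2 ^ (n - 1) * (\<Sum>k = 0..n - 2. real ((n - 2) choose k) * (p (k + 1) + p (k + 2)))"
proof -
  have "n - 1 = Suc (n - 2)" using assms by simp
  then show ?thesis
    using binomial_sum_pascal[of "n - 2" "\<lambda>k. p (k + 1)"] by (simp add: binom_mean_def)
qed

lemma power_two_pred:
  assumes "2 \<le> n"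
  shows "(2::real) ^ (n - 1) = 2 * 2 ^ (n - 2)" and "(2::real) ^ n = 4 * 2 ^ (n - 2)"
proof -
  obtain m where "n = m + 2" using assms le_Suc_ex by (metis add.commute)
  then show "(2::real) ^ (n - 1) = 2 * 2 ^ (n - 2)" and "(2::real) ^ n = 4 * 2 ^ (n - 2)"
    by simp_all
qed

lemma binomial_row_sum: "(\<Sum>k = 0..m. real (m choose k)) = 2 ^ m"
  using choose_row_sum[of m] by (metis atMost_atLeast0 of_nat_numeral of_nat_power of_nat_sum)

text \<open>Reflecting row \<open>n - 2\<close> turns the sum of \<open>p (n - (k + 1))\<close> into
  that of \<open>p (k + 1)\<close>; what remains is the mean of \<open>p\<close> as rewritten by
  Pascal's rule.\<close>

lemma psi_polar_const:
  assumes "2 \<le> n"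
  shows "psi_polar n (\<lambda>i. 1) p = 0"
proof -
  let ?c = "\<lambda>k. real ((n - 2) choose k)"
  have "binom_mean n (\<lambda>i. 1) = 1"
    unfolding binom_mean_pascal[OF assms] power_two_pred[OF assms]
    by (simp add: binomial_row_sum flip: sum_distrib_right)
  moreover have "(\<Sum>k = 0..n - 2. ?c k * p (n - (k + 1))) = (\<Sum>k = 0..n - 2. ?c k * p (k + 1))"
    by (subst binomial_sum_reflect[of "n - 2" "\<lambda>k. p (k + 1)", symmetric])
      (rule sum.cong, use assms in \<open>auto simp: Suc_diff_le numeral_2_eq_2 Suc_diff_Suc\<close>)
  ultimately show ?thesis
    by (simp add: psi_polar_def binom_mean_pascal[OF assms] algebra_simps sum.distrib add_divide_distrib
        sum_divide_distrib[symmetric])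
qed

lemma psi_shift:
  assumes "2 \<le> n"
  shows "psi n (\<lambda>i. c + b * p i) = b\<^sup>2 * psi n p"
  using psi_comb[of n c "\<lambda>i. 1" b p] psi_polar_const[OF assms] by (simp add: psi_eq_polar)

text \<open>Symmetry replaces \<open>p (n - (k + 1))\<close> by \<open>p (k + 2)\<close>, and
  reflecting the row equates the weighted sums of \<open>(p (k + 1))^2\<close> and
  \<open>(p (k + 2))^2\<close>; this completes the square.\<close>

lemma psi_sym:
  assumes n: "2 \<le> n" and p: "\<not> nonsym n p"
  shows "psi n p = (binom_mean n p)\<^sup>2
    - 1 / 2 ^ n * (\<Sum>k = 0..n - 2. real ((n - 2) choose k) * (p (k + 1) + p (k + 2))\<^sup>2)"
proof -
  let ?c = "\<lambda>k. real ((n - 2) choose k)"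
  have refl: "p k = p (n + 1 - k)" if "1 \<le> k" "k \<le> n" for k
    using p that by (auto simp: nonsym_def)
  have 1: "(\<Sum>k = 0..n - 2. ?c k * (p (k + 2))\<^sup>2) = (\<Sum>k = 0..n - 2. ?c k * (p (k + 1))\<^sup>2)"
  proof (subst binomial_sum_reflect[of "n - 2" "\<lambda>k. (p (k + 1))\<^sup>2", symmetric], rule sum.cong)
    fix k assume "k \<in> {0..n - 2}"
    then have "n - 2 - k + 1 = n + 1 - (k + 2)" "k + 2 \<le> n"
      using n by auto
    then have "p (k + 2) = p (n - 2 - k + 1)"
      using refl[of "k + 2"] n by simp
    then show "?c k * (p (k + 2))\<^sup>2 = ?c k * (p (n - 2 - k + 1))\<^sup>2" by simp
  qed simp
  have 2: "(\<Sum>k = 0..n - 2. ?c k * (p (k + 1) * p (n - (k + 1)))) = (\<Sum>k = 0..n - 2. ?c k * (p (k + 1) * p (k + 2)))"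
  proof (rule sum.cong)
    fix k assume "k \<in> {0..n - 2}"
    then have "p (k + 2) = p (n - (k + 1))"
      using refl[of "k + 2"] n by simp
    then show "?c k * (p (k + 1) * p (n - (k + 1))) = ?c k * (p (k + 1) * p (k + 2))" by simp
  qed simp
  have 3: "(p (k + 1) + p (k + 2))\<^sup>2 = (p (k + 1))\<^sup>2 + (p (k + 2))\<^sup>2 + 2 * (p (k + 1) * p (k + 2))" for k
    by (simp add: power2_sum)
  define A where "A = (\<Sum>k = 0..n - 2. ?c k * (p (k + 1))\<^sup>2)"
  define D where "D = (\<Sum>k = 0..n - 2. ?c k * (p (k + 1) * p (k + 2)))"
  have "(\<Sum>k = 0..n - 2. ?c k * ((p (k + 2))\<^sup>2 + p (k + 1) * p (n - (k + 1)))) = A + D"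
    using 1 2 unfolding A_def D_def by (simp only: distrib_left sum.distrib)
  moreover have "(\<Sum>k = 0..n - 2. ?c k * (p (k + 1) + p (k + 2))\<^sup>2) = 2 * (A + D)"
    using 1 unfolding A_def D_def 3
    by (simp only: distrib_left sum.distrib mult.left_commute[of _ 2] sum_distrib_left[symmetric])
  moreover have "1 / (2 * x) * y = 1 / (4 * x) * (2 * y)" for x y :: real
    by (simp add: field_simps)
  ultimately show ?thesis
    unfolding psi_def binom_mean_def power_two_pred[OF n] by (simp only:)
qed

text \<open>Here \<open>psi\<close> is minus the variance of
  \<open>(p (k + 1) + p (k + 2)) / 2\<close> for \<open>k\<close> binomial with parameters
  \<open>n - 2\<close> and 1/2.\<close>

lemma psi_sym_nonpos:
  assumes n: "2 \<le> n" and p: "\<not> nonsym n p"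
  shows "psi n p \<le> 0"
proof -
  let ?c = "\<lambda>k. real ((n - 2) choose k)"
  let ?g = "\<lambda>k. p (k + 1) + p (k + 2)"
  have "(\<Sum>k = 0..n - 2. sqrt (?c k) * (sqrt (?c k) * ?g k))\<^sup>2
      \<le> (\<Sum>k = 0..n - 2. (sqrt (?c k))\<^sup>2) * (\<Sum>k = 0..n - 2. (sqrt (?c k) * ?g k)\<^sup>2)"
    by (rule Cauchy_Schwarz_ineq_sum)
  moreover have "sqrt (?c k) * (sqrt (?c k) * ?g k) = ?c k * ?g k" for k
    by (simp only: mult.assoc[symmetric]) simp
  ultimately have cs: "(\<Sum>k = 0..n - 2. ?c k * ?g k)\<^sup>2 \<le> 2 ^ (n - 2) * (\<Sum>k = 0..n - 2. ?c k * (?g k)\<^sup>2)"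
    by (simp only: power_mult_distrib real_sqrt_pow2 of_nat_0_le_iff binomial_row_sum)
  define X where "X = (\<Sum>k = 0..n - 2. ?c k * ?g k)"
  define Y where "Y = (\<Sum>k = 0..n - 2. ?c k * (?g k)\<^sup>2)"
  define T :: real where "T = 2 ^ (n - 2)"
  have "0 < T" "X\<^sup>2 \<le> T * Y"
    using cs by (auto simp: X_def Y_def T_def)
  then have "(1 / (2 * T) * X)\<^sup>2 - 1 / (4 * T) * Y \<le> 0"
    by (simp add: power_mult_distrib power_divide field_simps power2_eq_square)
  then show ?thesis
    unfolding psi_sym[OF assms] binom_mean_pascal[OF n] power_two_pred[OF n] X_def Y_def T_def .
qed


section \<open>Influence is asymmetry\<close>

text \<open>Otherwise \<open>p\<close> would be constant on \<open>{1..n}\<close>, hence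
  symmetric.\<close>

lemma nonsym_imp_consecutive:
  assumes "nonsym n p"
  shows "\<exists>k\<in>{1..<n}. p k \<noteq> p (k + 1)"
proof (rule ccontr)
  assume "\<not> ?thesis"
  then have step: "p k = p (k + 1)" if "1 \<le> k" "k < n" for k using that by auto
  have const: "p (Suc k) = p 1" if "k < n" for k
    using that by (induction k) (use step in auto)
  from assms obtain k where k: "k \<in> {1..n}" "p k \<noteq> p (n + 1 - k)"
    by (auto simp: nonsym_def)
  then have "k - 1 < n" "n - k < n" by auto
  then show False
    using k const[of "k - 1"] const[of "n - k"] by (simp add: Suc_diff_le)
qed

lemma prob_at_indicator:
  assumes "i \<in> A" "A \<subseteq> {1..n}"
  shows "prob_at n p i (\<lambda>k\<in>{1..n}. if k \<in> A then 1 else 0) = p (card A)"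
proof -
  have "{j \<in> {1..n}. (\<lambda>k\<in>{1..n}. if k \<in> A then 1 else (0::nat)) j = (\<lambda>k\<in>{1..n}. if k \<in> A then 1 else 0) i} = A"
    using assms by auto
  then show ?thesis by (simp add: prob_at_def)
qed

text \<open>After the flip, \<open>i\<close> agrees with itself and with exactly those that
  disagreed with it before.\<close>

lemma prob_at_flip_self:
  assumes "x \<in> bitvecs n" "i \<in> {1..n}"
  shows "prob_at n p i (flip i x) = p (n + 1 - card {j \<in> {1..n}. x j = x i})"
proof -
  let ?S = "{j \<in> {1..n}. x j = x i}"
  have bit: "x j = 0 \<or> x j = 1" if "j \<in> {1..n}" for j
    using assms(1) that by (auto simp: bitvecs_def)
  have "{j \<in> {1..n}. flip i x j = flip i x i} = insert i ({1..n} - ?S)"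
  proof (intro set_eqI iffI)
    fix j assume "j \<in> {j \<in> {1..n}. flip i x j = flip i x i}"
    then show "j \<in> insert i ({1..n} - ?S)"
      using bit[of i] assms(2) by (auto simp: flip_def split: if_splits)
  next
    fix j assume "j \<in> insert i ({1..n} - ?S)"
    then show "j \<in> {j \<in> {1..n}. flip i x j = flip i x i}"
      using bit[of i] bit[of j] assms(2) by (auto simp: flip_def)
  qed
  moreover have "card (insert i ({1..n} - ?S)) = Suc (card ({1..n} - ?S))"
    using assms(2) by (subst card_insert_disjoint) auto
  moreover have "card ({1..n} - ?S) = n - card ?S"
    by (subst card_Diff_subset) auto
  moreover have "card ?S \<le> n"
    using card_mono[of "{1..n}" ?S] by fastforce
  ultimately show ?thesis
    by (simp add: prob_at_def Suc_diff_le)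
qed

text \<open>For \<open>i = j\<close> a flip exchanges the agreement counts \<open>k\<close> and
  \<open>n + 1 - k\<close>, and every \<open>k\<close> in \<open>{1..n}\<close> occurs. For
  \<open>i \<noteq> j\<close> it changes the count by one, and asymmetry supplies consecutive
  unequal coordinates.\<close>

lemma Inf_set_iff:
  assumes n: "2 \<le> n"
  shows "p \<in> Inf_set n \<longleftrightarrow> p \<in> {1..n} \<rightarrow>\<^sub>E {0..1} \<and> nonsym n p"
proof (intro iffI conjI)
  assume p: "p \<in> Inf_set n"
  then show "p \<in> {1..n} \<rightarrow>\<^sub>E {0..1}" by (simp add: Inf_set_def)
  have 1: "1 \<in> {1..n}" using n by simp
  with p obtain x where x: "x \<in> bitvecs n" "prob_at n p 1 x \<noteq> prob_at n p 1 (flip 1 x)"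
    unfolding Inf_set_def by blast
  define S where "S = {j \<in> {1..n}. x j = x 1}"
  have "finite S" by (simp add: S_def)
  have "S \<noteq> {}" using 1 by (auto simp: S_def)
  then have "card S \<noteq> 0" using \<open>finite S\<close> by simp
  moreover have "S \<subseteq> {1..n}" by (auto simp: S_def)
  then have "card S \<le> n"
    using card_mono[of "{1..n}" S] by simp
  ultimately have "card S \<in> {1..n}" by simp
  moreover have "p (card S) \<noteq> p (n + 1 - card S)"
    using x(2) unfolding prob_at_flip_self[OF x(1) 1] by (simp add: prob_at_def S_def)
  ultimately show "nonsym n p" unfolding nonsym_def by blast
next
  assume p: "p \<in> {1..n} \<rightarrow>\<^sub>E {0..1} \<and> nonsym n p"
  have "\<exists>x\<in>bitvecs n. prob_at n p i x \<noteq> prob_at n p i (flip j x)"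
    if i: "i \<in> {1..n}" and j: "j \<in> {1..n}" for i j
  proof (cases "i = j")
    case True
    from p obtain k where k: "k \<in> {1..n}" "p k \<noteq> p (n + 1 - k)"
      by (auto simp: nonsym_def)
    have "k - 1 \<le> card ({1..n} - {i})" using i k(1) by (simp add: diff_le_mono)
    then obtain B where B: "B \<subseteq> {1..n} - {i}" "card B = k - 1" "finite B"
      using obtain_subset_with_card_n by metis
    define x where "x = (\<lambda>l\<in>{1..n}. if l \<in> insert i B then 1 else (0::nat))"
    have card: "card (insert i B) = k"
      using B k by (subst card_insert_disjoint) auto
    have xb: "x \<in> bitvecs n" by (auto simp: x_def bitvecs_def)
    have "{j \<in> {1..n}. x j = x i} = insert i B"
      using B i by (auto simp: x_def split: if_splits)
    then have "prob_at n p i x = p k" "prob_at n p i (flip i x) = p (n + 1 - k)"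
      using prob_at_flip_self[OF xb i] card by (simp_all add: prob_at_def)
    then have "prob_at n p i x \<noteq> prob_at n p i (flip j x)"
      using k(2) True by simp
    then show ?thesis using xb by blast
  next
    case False
    from p obtain k where k: "k \<in> {1..<n}" "p k \<noteq> p (k + 1)"
      using nonsym_imp_consecutive by blast
    \<comment> \<open>The ones sit at \<open>i\<close> and at \<open>k - 1\<close> places other than
      \<open>i\<close> and \<open>j\<close>; flipping the zero at \<open>j\<close> raises the count
      from \<open>k\<close> to \<open>k + 1\<close>.\<close>
    have "k - 1 \<le> n - 2" using k(1) by auto
    then have "k - 1 \<le> card ({1..n} - {i, j})" using i j False by (simp add: card_Diff_subset)
    then obtain B where B: "B \<subseteq> {1..n} - {i, j}" "card B = k - 1" "finite B"
      using obtain_subset_with_card_n by metis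
    define x where "x = (\<lambda>A. \<lambda>l\<in>{1..n}. if l \<in> A then 1 else (0::nat))"
    have card: "card (insert i B) = k" "card (insert j (insert i B)) = k + 1"
      using B k False by (auto simp: card_insert_if)
    have "flip j (x (insert i B)) = x (insert j (insert i B))"
      using B j False by (auto simp: x_def flip_def fun_eq_iff)
    then have "prob_at n p i (x (insert i B)) = p k" "prob_at n p i (flip j (x (insert i B))) = p (k + 1)"
      using prob_at_indicator[of i "insert i B" n p] prob_at_indicator[of i "insert j (insert i B)" n p] B i j card
      by (auto simp: x_def)
    moreover have "x (insert i B) \<in> bitvecs n" by (auto simp: x_def bitvecs_def)
    ultimately show ?thesis using k by metis
  qed
  then show "p \<in> Inf_set n" using p by (simp add: Inf_set_def)
qed

lemma GST_iff:
  assumes "2 \<le> n"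
  shows "p \<in> GST n \<longleftrightarrow> p \<in> {1..n} \<rightarrow>\<^sub>E {0..1} \<and> psi n p = 0 \<and> nonsym n p"
  using Inf_set_iff[OF assms] by (auto simp: GST_def Ind_def)

section \<open>Disconnectedness for three and four\<close>

lemma not_connected_GST:
  fixes f :: "(nat \<Rightarrow> real) \<Rightarrow> real"
  assumes "continuous_map (powertop_real {1..n}) euclidean f"
    and "\<And>p. p \<in> GST n \<Longrightarrow> f p \<noteq> 0"
    and "p \<in> GST n" "f p < 0" "q \<in> GST n" "0 < f q"
  shows "\<not> connected_space (GST_topology n)"
proof
  assume "connected_space (GST_topology n)"
  then have "connectedin (powertop_real {1..n}) (GST n)"
    by (auto simp: GST_topology_def connectedin_def GST_def Ind_def)
  then have "connected (f ` GST n)"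
    using connectedin_continuous_map_image[OF assms(1)] by simp
  then have "0 \<in> f ` GST n"
    using assms(3-6) by (meson connectedD_interval imageI less_imp_le)
  then show False using assms(2) by auto
qed

lemma psi_3: "psi 3 p = (p 1 - p 3) * (p 1 + 3 * p 3 - 4 * p 2) / 16"
  by (simp add: psi_def numeral_eq_Suc power2_eq_square field_simps)

lemma nonsym_3: "nonsym 3 p \<longleftrightarrow> p 1 \<noteq> p 3"
proof -
  have "{1..3::nat} = {1, 2, 3}" by auto
  then show ?thesis by (auto simp: nonsym_def)
qed

lemma not_connected_GST_3: "\<not> connected_space (GST_topology 3)"
proof (rule not_connected_GST)
  \<comment> \<open>Both points satisfy \<open>p 1 + 3 * p 3 = 4 * p 2\<close>, the second factor of
    \<open>psi 3\<close>; they are reflections of each other in the centre of the cube.\<close>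
  let ?p = "\<lambda>i\<in>{1..3::nat}. if i = 1 then 0 else if i = 2 then 3/4 else 1 :: real"
  let ?q = "\<lambda>i\<in>{1..3::nat}. if i = 1 then 1 else if i = 2 then 1/4 else 0 :: real"
  show "continuous_map (powertop_real {1..3}) euclidean (\<lambda>p :: nat \<Rightarrow> real. p 1 - p 3)"
    by (intro continuous_map_diff continuous_map_product_projection) auto
  show "p 1 - p 3 \<noteq> 0" if "p \<in> GST 3" for p
    using that by (simp add: GST_iff nonsym_3)
  show "?p \<in> GST 3" "?q \<in> GST 3"
    by (auto simp: GST_iff nonsym_3 psi_3)
qed auto

lemma psi_4: "psi 4 p = ((p 1 + 3 * p 2 + 3 * p 3 + p 4)\<^sup>2
    - 8 * (3 * (p 2)\<^sup>2 + 2 * (p 3)\<^sup>2 + (p 4)\<^sup>2 + 2 * p 1 * p 3)) / 64"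
  by (simp add: psi_def numeral_eq_Suc power2_eq_square field_simps)

lemma nonsym_4: "nonsym 4 p \<longleftrightarrow> p 1 \<noteq> p 4 \<or> p 2 \<noteq> p 3"
proof -
  have "{1..4::nat} = {1, 2, 3, 4}" by auto
  then show ?thesis by (auto simp: nonsym_def)
qed

text \<open>On the hyperplane where this linear form vanishes, \<open>- psi 4\<close> is a sum of
  squares that is zero only at constant points, which are symmetric.\<close>

lemma GST_4_nonzero:
  assumes "p \<in> GST 4"
  shows "p 1 - p 4 + 3 * (p 2 - p 3) \<noteq> 0"
proof
  assume "p 1 - p 4 + 3 * (p 2 - p 3) = 0"
  then have p1: "p 1 = p 4 + 3 * p 3 - 3 * p 2" by simp
  have "psi 4 p = - (4 * (p 4 - p 3)\<^sup>2 + 24 * (p 2 - p 3)\<^sup>2) / 64"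
    unfolding psi_4 p1 by (simp add: power2_eq_square algebra_simps)
  then have "4 * (p 4 - p 3)\<^sup>2 + 24 * (p 2 - p 3)\<^sup>2 = 0"
    using assms by (simp add: GST_iff)
  then have "p 4 = p 3 \<and> p 2 = p 3"
    by (smt (verit) power2_less_eq_zero_iff zero_le_power2 right_minus_eq)
  then show False using assms p1 by (simp add: GST_iff nonsym_4)
qed

lemma not_connected_GST_4: "\<not> connected_space (GST_topology 4)"
proof (rule not_connected_GST)
  \<comment> \<open>A direction \<open>(x, 0, 0, y)\<close> is a zero of \<open>psi 4\<close> iff
    \<open>(x + y)^2 = 8 * y^2\<close>, which these values solve. The linear form takes the value
    \<open>2 * sqrt 2 * c\<close>, so the sign of \<open>c\<close> decides; \<open>1/20\<close> is
    small enough to stay in the cube.\<close>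
  let ?p = "\<lambda>c. \<lambda>i\<in>{1..4::nat}. 1/2 + c * (if i = 1 then 3 * sqrt 2 + 2 else if i = 4 then sqrt 2 + 2 else 0)"
  show "continuous_map (powertop_real {1..4}) euclidean (\<lambda>p :: nat \<Rightarrow> real. p 1 - p 4 + 3 * (p 2 - p 3))"
    by (intro continuous_map_diff continuous_map_add continuous_map_real_mult
        continuous_map_product_projection) auto
  show "p 1 - p 4 + 3 * (p 2 - p 3) \<noteq> 0" if "p \<in> GST 4" for p
    using GST_4_nonzero[OF that] .
  have rt: "1 < sqrt 2" "sqrt 2 < 3 / 2"
    by (simp, rule real_less_lsqrt) (auto simp: power2_eq_square)
  have "?p c \<in> GST 4" if "\<bar>c\<bar> = 1 / 20" for c
  proof -
    have "\<bar>3 * sqrt 2 + 2\<bar> \<le> 10" "\<bar>sqrt 2 + 2\<bar> \<le> 10" using rt by linarith+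
    moreover have "\<bar>c * x\<bar> \<le> 1 / 2" if "\<bar>x\<bar> \<le> 10" for x
      unfolding abs_mult \<open>\<bar>c\<bar> = 1 / 20\<close> using that by simp
    ultimately have "\<bar>c * (3 * sqrt 2 + 2)\<bar> \<le> 1 / 2" "\<bar>c * (sqrt 2 + 2)\<bar> \<le> 1 / 2"
      by blast+
    then have "1 / 2 + c * (3 * sqrt 2 + 2) \<in> {0..1}" "1 / 2 + c * (sqrt 2 + 2) \<in> {0..1}"
      by (simp_all only: atLeastAtMost_iff abs_le_iff) linarith+
    then have "?p c \<in> {1..4} \<rightarrow>\<^sub>E {0..1}" by auto
    moreover have "psi 4 (?p c) = 0"
      by (simp add: psi_4 power2_eq_square algebra_simps)
    moreover have "nonsym 4 (?p c)"
      using that by (auto simp: nonsym_4)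
    ultimately show ?thesis by (simp add: GST_iff)
  qed
  from this[of "1/20"] this[of "-1/20"] show "?p (-1/20) \<in> GST 4" "?p (1/20) \<in> GST 4" by auto
qed (auto simp: algebra_simps)

section \<open>Connectedness\<close>

text \<open>The cube constraint is dropped and coordinates outside \<open>{1..n}\<close> are left
  free, so that linear operations apply directly.\<close>

definition asym_cone :: "nat \<Rightarrow> (nat \<Rightarrow> real) set" where
  "asym_cone n = {p. psi n p = 0 \<and> nonsym n p}"

definition asym_nonneg :: "nat \<Rightarrow> (nat \<Rightarrow> real) set" where
  "asym_nonneg n = {p. 0 \<le> psi n p \<and> nonsym n p}"

text \<open>At \<open>x\<close> times the second unit vector minus the one of index
  \<open>n - 2\<close>, the second sum of \<open>psi\<close> is
  \<open>x^2 - 2 * (n - 2) * x + ((n - 2) choose 2)\<close> when \<open>n \<ge> 6\<close>;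
  \<open>x = n - 2\<close> minimises it.\<close>

definition pos_vec :: "nat \<Rightarrow> real \<Rightarrow> real \<Rightarrow> nat \<Rightarrow> real" where
  "pos_vec n a b i = (if i = 1 then a else if i = 2 then real (n - 2) * b else if i = n - 2 then - b else 0)"

lemma binom_mean_pos_vec:
  assumes "6 \<le> n"
  shows "binom_mean n (pos_vec n a 0) = a / 2 ^ (n - 1)"
proof -
  have "(\<Sum>k = 0..n - 1. real ((n - 1) choose k) * pos_vec n a 0 (k + 1))
      = (\<Sum>k\<in>{0}. real ((n - 1) choose k) * pos_vec n a 0 (k + 1))"
    by (rule sum.mono_neutral_right) (auto simp: pos_vec_def)
  then show ?thesis by (simp add: binom_mean_def pos_vec_def)
qed

text \<open>The first coordinate enters the second sum only multiplied by coordinate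
  \<open>n - 1\<close>, which is zero. Only \<open>k = 0, 1, n - 4, n - 3\<close> contribute, and
  the first two cancel; \<open>n \<ge> 6\<close> keeps these indices distinct.\<close>

lemma psi_pos_vec:
  assumes n: "6 \<le> n"
  shows "psi n (pos_vec n a b) = (binom_mean n (pos_vec n a b))\<^sup>2
    + b\<^sup>2 * ((real (n - 2))\<^sup>2 - real ((n - 2) choose 2)) / 2 ^ (n - 1)"
proof -
  let ?p = "pos_vec n a b"
  let ?f = "\<lambda>k. real ((n - 2) choose k) * ((?p (k + 2))\<^sup>2 + ?p (k + 1) * ?p (n - (k + 1)))"
  have "n - 4 \<noteq> 0" "n - 4 \<noteq> 1" "n - 3 \<noteq> 0" "n - 3 \<noteq> 1" "n - 4 \<noteq> n - 3"
    using n by auto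
  then have sum4: "(\<Sum>k\<in>{0, 1, n - 4, n - 3}. ?f k) = ?f 0 + ?f 1 + ?f (n - 4) + ?f (n - 3)"
    by (simp only: sum.insert finite.intros insert_iff empty_iff simp_thms sum.empty add_0_right add.assoc
        not_sym[of "n - 4"] not_sym[of "n - 3"] zero_neq_one)
  have "(\<Sum>k = 0..n - 2. ?f k) = (\<Sum>k\<in>{0, 1, n - 4, n - 3}. ?f k)"
  proof (rule sum.mono_neutral_right)
    show "\<forall>k\<in>{0..n - 2} - {0, 1, n - 4, n - 3}. ?f k = 0"
    proof
      fix k assume k: "k \<in> {0..n - 2} - {0, 1, n - 4, n - 3}"
      then have "k + 2 \<noteq> n - 2" "k + 1 \<noteq> n - 2" "k \<noteq> 0" "k \<noteq> 1"
        using n by auto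
      then show "?f k = 0" by (simp add: pos_vec_def)
    qed
  qed (use n in auto)
  also note sum4
  also have "?f 0 = (real (n - 2))\<^sup>2 * b\<^sup>2"
    using n by (auto simp: pos_vec_def power_mult_distrib)
  also have "?f 1 = - (real (n - 2))\<^sup>2 * b\<^sup>2"
    using n by (auto simp: pos_vec_def power2_eq_square)
  also have "?f (n - 4) = real ((n - 2) choose 2) * b\<^sup>2"
  proof -
    have "(n - 2) choose (n - 4) = (n - 2) choose 2"
      using binomial_symmetric[of 2 "n - 2"] n by simp
    moreover have "n - 4 + 2 = n - 2" "n - (n - 4 + 1) = 3" "n - 4 + 1 = n - 3" using n by auto
    ultimately show ?thesis using n by (auto simp: pos_vec_def)
  qed
  also have "?f (n - 3) = - (real (n - 2))\<^sup>2 * b\<^sup>2"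
  proof -
    have "(n - 2) choose (n - 3) = n - 2"
    proof -
      have e: "n - 2 - 1 = n - 3" "1 \<le> n - 2" using n by auto
      then show ?thesis using binomial_symmetric[of 1 "n - 2", unfolded e(1)] by simp
    qed
    moreover have "n - 3 + 2 = n - 1" "n - (n - 3 + 1) = 2" "n - 3 + 1 = n - 2" using n by auto
    ultimately show ?thesis using n by (auto simp: pos_vec_def power2_eq_square)
  qed
  finally have "(\<Sum>k = 0..n - 2. ?f k) = - b\<^sup>2 * ((real (n - 2))\<^sup>2 - real ((n - 2) choose 2))"
    by (simp add: algebra_simps)
  then show ?thesis by (simp add: psi_def binom_mean_def)
qed

lemma psi_pos_vec_pos:
  assumes n: "6 \<le> n" and ab: "(a, b) \<noteq> (0, 0)"
  shows "0 < psi n (pos_vec n a b)"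
proof (cases "b = 0")
  case True
  then show ?thesis using ab binom_mean_pos_vec[OF n, of a] by (simp add: psi_pos_vec[OF n])
next
  case False
  have "(n - 2) choose 2 \<le> (n - 2) * (n - 2 - 1)"
    by (simp add: choose_two)
  also have "\<dots> < (n - 2)\<^sup>2" using n by (simp add: power2_eq_square)
  finally have "real ((n - 2) choose 2) < (real (n - 2))\<^sup>2"
    by (metis of_nat_less_iff of_nat_power)
  then show ?thesis using False unfolding psi_pos_vec[OF n]
    by (intro add_nonneg_pos) auto
qed

text \<open>Two dimensions are what allows opposite vectors to be joined while avoiding the
  origin.\<close>

lemma connected_pos_vec: "connected ((\<lambda>(a, b). pos_vec n a b) ` (- {(0, 0)}))"
proof (rule connected_continuous_image)
  show "continuous_on (- {(0, 0)}) (\<lambda>(a, b). pos_vec n a b)"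
    unfolding case_prod_beta
  proof (rule continuous_on_coordinatewise_then_product)
    show "continuous_on (- {(0, 0)}) (\<lambda>x. pos_vec n (fst x) (snd x) i)" for i
      by (cases "i = 1"; cases "i = 2"; cases "i = n - 2") (auto simp: pos_vec_def intro!: continuous_intros)
  qed
  show "connected (- {(0, 0) :: real \<times> real})"
    by (rule connected_punctured_universe) simp
qed

text \<open>
  A point of \<^term>\<open>asym_nonneg n\<close> moves along a segment to whichever of
  \<open>\<plusminus>e\<^sub>1\<close> pairs nonnegatively with it; on the way \<^const>\<open>psi\<close> is
  positive, hence the points are asymmetric.
\<close>

lemma connected_component_pos_vec:
  assumes n: "6 \<le> n" and v: "v \<in> asym_nonneg n"
  shows "\<exists>a. a \<noteq> 0 \<and> connected_component (asym_nonneg n) v (pos_vec n a 0)"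
proof -
  have neg: "pos_vec n (-1) 0 = (\<lambda>i. (-1) * pos_vec n 1 0 i + 0 * pos_vec n 1 0 i)"
    by (auto simp: pos_vec_def)
  have "psi_polar n v (pos_vec n (-1) 0) = - psi_polar n v (pos_vec n 1 0)"
    unfolding neg psi_polar_sym[of n v] psi_polar_lin by simp
  then obtain a :: real where a: "a \<noteq> 0" "0 \<le> psi_polar n v (pos_vec n a 0)"
    by (metis linorder_linear neg_0_le_iff_le neg_equal_0_iff_equal one_neq_zero)
  define g where "g t = (\<lambda>i. (1 - t) * v i + t * pos_vec n a 0 i)" for t
  have "g t \<in> asym_nonneg n" if "t \<in> {0..1}" for t
  proof (cases "t = 0")
    case True
    then show ?thesis using v by (simp add: g_def)
  next
    case False
    then have "0 < t\<^sup>2 * psi n (pos_vec n a 0)"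
      using psi_pos_vec_pos[OF n, of a 0] a by simp
    moreover have "0 \<le> (1 - t)\<^sup>2 * psi n v" "0 \<le> 2 * (1 - t) * t * psi_polar n v (pos_vec n a 0)"
      using v a that by (auto simp: asym_nonneg_def)
    ultimately have "0 < psi n (g t)" unfolding g_def psi_comb by linarith
    then show ?thesis
      using psi_sym_nonpos[of n "g t"] n by (auto simp: asym_nonneg_def not_less)
  qed
  moreover have "connected (g ` {0..1})"
    unfolding g_def
    by (intro connected_continuous_image continuous_on_coordinatewise_then_product continuous_intros) auto
  moreover have "g 0 = v" "g 1 = pos_vec n a 0"
    by (auto simp: g_def)
  ultimately show ?thesis
    unfolding connected_component_def using a(1)
    by (metis atLeastAtMost_iff image_eqI image_subsetI order_refl zero_le_one)
qed

text \<open>Every point is joined to a nonzero multiple of the first unit vector, and the punctured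
  plane joins all these multiples.\<close>

lemma connected_asym_nonneg:
  assumes n: "6 \<le> n"
  shows "connected (asym_nonneg n)"
  unfolding connected_iff_connected_component
proof (intro ballI)
  fix v w assume vw: "v \<in> asym_nonneg n" "w \<in> asym_nonneg n"
  obtain a where a: "a \<noteq> 0" "connected_component (asym_nonneg n) v (pos_vec n a 0)"
    using connected_component_pos_vec[OF n vw(1)] by blast
  obtain b where b: "b \<noteq> 0" "connected_component (asym_nonneg n) w (pos_vec n b 0)"
    using connected_component_pos_vec[OF n vw(2)] by blast
  let ?P = "(\<lambda>(a, b). pos_vec n a b) ` (- {(0, 0)})"
  have "?P \<subseteq> asym_nonneg n"
  proof
    fix x assume "x \<in> ?P"
    then obtain a b where ab: "x = pos_vec n a b" "(a, b) \<noteq> (0, 0)" by auto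
    from ab(2) have "0 < psi n (pos_vec n a b)" by (rule psi_pos_vec_pos[OF n])
    then show "x \<in> asym_nonneg n"
      using psi_sym_nonpos[of n "pos_vec n a b"] n ab(1) by (auto simp: asym_nonneg_def not_less)
  qed
  moreover have "pos_vec n a 0 \<in> ?P" "pos_vec n b 0 \<in> ?P"
    using a b by force+
  ultimately have "connected_component (asym_nonneg n) (pos_vec n a 0) (pos_vec n b 0)"
    using connected_pos_vec unfolding connected_component_def by metis
  then show "connected_component (asym_nonneg n) v w"
    using a(2) b(2) by (meson connected_component_sym connected_component_trans)
qed

section \<open>Pushing the asymmetric region onto the cone of zeros\<close>

lemma continuous_on_binom_mean: "continuous_on S (binom_mean n)"
  unfolding binom_mean_def
  by (intro continuous_intros continuous_on_product_then_coordinatewise continuous_on_id)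

lemma continuous_on_psi_polar: "continuous_on S (\<lambda>p. psi_polar n p q)"
  unfolding psi_polar_def
  by (intro continuous_intros continuous_on_binom_mean continuous_on_product_then_coordinatewise continuous_on_id) auto

lemma continuous_on_psi: "continuous_on S (psi n)"
  unfolding psi_def
  by (intro continuous_intros continuous_on_product_then_coordinatewise continuous_on_id) auto

lemma nonsym_add_sym:
  assumes "nonsym n p" "\<not> nonsym n h"
  shows "nonsym n (\<lambda>i. p i + t * h i)"
  using assms by (auto simp: nonsym_def)

text \<open>
  For symmetric \<open>h\<close> with \<open>psi n h < 0\<close>, adding to \<open>p\<close> the multiple \<open>t h\<close>, \<open>t\<close> being the larger
  root of a quadratic equation, maps \<^term>\<open>asym_nonneg n\<close> continuously into the cone, and fixes
  the points of the cone that pair nonpositively with \<open>h\<close>.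
\<close>

lemma half_cone_in_connected:
  assumes n: "6 \<le> n" and h: "\<not> nonsym n h" "psi n h < 0"
  obtains T where "connected T" "T \<subseteq> asym_cone n" "{p \<in> asym_cone n. psi_polar n p h \<le> 0} \<subseteq> T"
proof
  define t where "t p = (psi_polar n p h + sqrt ((psi_polar n p h)\<^sup>2 - psi n h * psi n p)) / (- psi n h)" for p
  define r where "r p = (\<lambda>i. p i + t p * h i)" for p
  have psi_r: "psi n (r p) = 0" if "0 \<le> psi n p" for p
  proof -
    define b c u where "b = psi_polar n p h" and "c = psi n h"
      and "u = sqrt ((psi_polar n p h)\<^sup>2 - psi n h * psi n p)"
    \<comment> \<open>The discriminant is nonnegative because
      \<open>psi n h < 0 \<le> psi n p\<close>.\<close>
    have "0 \<le> (psi_polar n p h)\<^sup>2 - psi n h * psi n p"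
      using that h(2) by (smt (verit) mult_nonpos_nonneg zero_le_power2)
    then have u: "u * u = b * b - c * psi n p" by (simp add: u_def b_def c_def power2_eq_square)
    have c: "c < 0" using h(2) by (simp add: c_def)
    have t: "t p = (b + u) / (- c)" by (simp add: t_def b_def c_def u_def)
    have "psi n (r p) = psi n p + 2 * t p * b + (t p)\<^sup>2 * c"
      using psi_comb[of n 1 p "t p" h] by (simp add: r_def b_def c_def)
    also have "\<dots> = (c * psi n p + u * u - b * b) / c"
      using c unfolding t by (simp add: field_simps power2_eq_square)
    finally show ?thesis using u by simp
  qed
  show "connected (r ` asym_nonneg n)"
  proof (rule connected_continuous_image)
    have "continuous_on (asym_nonneg n) t"
      unfolding t_def using h(2)
      by (intro continuous_intros continuous_on_psi_polar continuous_on_psi) auto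
    then show "continuous_on (asym_nonneg n) r"
      unfolding r_def
      by (intro continuous_on_coordinatewise_then_product continuous_on_add continuous_on_mult_right
          continuous_on_subset[OF continuous_on_product_coordinates] subset_UNIV)
  qed (rule connected_asym_nonneg[OF n])
  show "r ` asym_nonneg n \<subseteq> asym_cone n"
    using psi_r nonsym_add_sym[OF _ h(1)] by (auto simp: asym_nonneg_def asym_cone_def r_def)
  show "{p \<in> asym_cone n. psi_polar n p h \<le> 0} \<subseteq> r ` asym_nonneg n"
  proof
    fix p assume p: "p \<in> {p \<in> asym_cone n. psi_polar n p h \<le> 0}"
    \<comment> \<open>With \<open>psi n p = 0\<close> the root is the absolute value of the pairing,
      which cancels the nonpositive pairing.\<close>
    then have "t p = 0" by (simp add: t_def asym_cone_def)
    then have "p = r p" by (simp add: r_def)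
    then show "p \<in> r ` asym_nonneg n"
      using p by (auto simp: asym_cone_def asym_nonneg_def)
  qed
qed

lemma connected_asym_cone_aux:
  assumes n: "6 \<le> n" and h: "\<not> nonsym n h" "psi n h < 0"
    and p: "p \<in> asym_cone n" "psi_polar n p h = 0"
  shows "connected (asym_cone n)"
proof -
  \<comment> \<open>This is \<open>- h\<close>, written as a combination so that
    \<open>psi_comb\<close> and \<open>psi_polar_lin\<close> apply.\<close>
  let ?h = "\<lambda>i. (-1) * h i + 0 * h i"
  have h': "\<not> nonsym n ?h" "psi n ?h < 0"
    using h unfolding psi_comb by (auto simp: nonsym_def)
  have neg: "psi_polar n q ?h = - psi_polar n q h" for q
    unfolding psi_polar_sym[of n q] psi_polar_lin by simp
  obtain S where S: "connected S" "S \<subseteq> asym_cone n" "{p \<in> asym_cone n. psi_polar n p h \<le> 0} \<subseteq> S"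
    by (rule half_cone_in_connected[OF n h])
  obtain T where T: "connected T" "T \<subseteq> asym_cone n" "{p \<in> asym_cone n. psi_polar n p ?h \<le> 0} \<subseteq> T"
    by (rule half_cone_in_connected[OF n h'])
  have "p \<in> S \<inter> T" using S T p neg by auto
  moreover have "asym_cone n = S \<union> T"
    using S T neg by (auto; smt (verit) mem_Collect_eq subsetD)
  ultimately show ?thesis using connected_Un[OF S(1) T(1)] by auto
qed

lemma connected_asym_cone:
  assumes n: "8 \<le> n"
  shows "connected (asym_cone n)"
proof -
  \<comment> \<open>Coordinate \<open>i\<close> has weight \<open>(n - 1) choose (i - 1)\<close> in
    the mean, so these values give mean zero; \<open>n \<ge> 8\<close> keeps the four positions
    distinct.\<close>
  define h :: "nat \<Rightarrow> real" where "h i = (if i = 3 \<or> i = n - 2 then 1 / real ((n - 1) choose 2)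
      else if i = 4 \<or> i = n - 3 then - 1 / real ((n - 1) choose 3) else 0)" for i
  \<comment> \<open>The second sum of \<open>psi\<close> at \<open>p\<close> is 1, from the last
    coordinate alone; the first coordinate is chosen so that the squared mean is
    \<open>1 / 2 ^ (n - 1)\<close>.\<close>
  define p :: "nat \<Rightarrow> real" where "p i = (if i = 1 then sqrt (2 ^ (n - 1)) - 1 else if i = n then 1 else 0)" for i
  have ch: "(n - 1) choose (n - 3) = (n - 1) choose 2" "(n - 1) choose (n - 4) = (n - 1) choose 3"
  proof -
    have e: "n - 1 - 2 = n - 3" "n - 1 - 3 = n - 4" "2 \<le> n - 1" "3 \<le> n - 1" using n by auto
    then show "(n - 1) choose (n - 3) = (n - 1) choose 2" "(n - 1) choose (n - 4) = (n - 1) choose 3"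
      using binomial_symmetric[of 2 "n - 1", unfolded e(1)] binomial_symmetric[of 3 "n - 1", unfolded e(2)]
      by simp_all
  qed
  have ch0: "(n - 1) choose 2 \<noteq> 0" "(n - 1) choose 3 \<noteq> 0"
    using n by (auto simp: binomial_eq_0_iff)
  have mean_h: "binom_mean n h = 0"
  proof -
    let ?f = "\<lambda>k. real ((n - 1) choose k) * h (k + 1)"
    have "2 \<noteq> n - 3" "3 \<noteq> n - 3" "2 \<noteq> n - 4" "3 \<noteq> n - 4" "n - 3 \<noteq> n - 4"
      using n by auto
    then have sum4: "(\<Sum>k\<in>{2, 3, n - 3, n - 4}. ?f k) = ?f 2 + ?f 3 + ?f (n - 3) + ?f (n - 4)"
      by (simp add: add.assoc)
    have "(\<Sum>k = 0..n - 1. ?f k) = (\<Sum>k\<in>{2, 3, n - 3, n - 4}. ?f k)"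
      using n by (intro sum.mono_neutral_right) (auto simp: h_def)
    also note sum4
    also have "?f 2 = 1" using ch0(1) by (simp add: h_def del: binomial_eq_0_iff)
    also have "?f 3 = - 1"
    proof -
      have "4 \<noteq> n - 2" using n by simp
      then show ?thesis using ch0(2) by (simp add: h_def del: binomial_eq_0_iff)
    qed
    also have "?f (n - 3) = 1"
    proof -
      have "n - 3 + 1 = n - 2" using n by simp
      then show ?thesis using ch0(1) unfolding ch by (simp add: h_def del: binomial_eq_0_iff)
    qed
    also have "?f (n - 4) = - 1"
    proof -
      have "n - 4 + 1 = n - 3" "n - 3 \<noteq> 3" "n - 3 \<noteq> n - 2" using n by auto
      then show ?thesis using ch0(2) unfolding ch by (simp add: h_def del: binomial_eq_0_iff)
    qed
    finally show ?thesis by (simp add: binom_mean_def)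
  qed
  have h_sym: "\<not> nonsym n h"
    using n by (auto simp: nonsym_def h_def)
  \<comment> \<open>The term \<open>k = 1\<close> is positive, since \<open>h 2 = 0\<close> and
    \<open>h 3 \<noteq> 0\<close>.\<close>
  have "0 < (\<Sum>k = 0..n - 2. real ((n - 2) choose k) * (h (k + 1) + h (k + 2))\<^sup>2)"
  proof (rule sum_pos2[of _ 1])
    have "h 2 = 0" using n by (simp add: h_def)
    moreover have "h 3 \<noteq> 0" using ch0(1) by (simp add: h_def del: binomial_eq_0_iff)
    ultimately show "0 < real ((n - 2) choose 1) * (h (1 + 1) + h (1 + 2))\<^sup>2"
      using n by (simp flip: numeral_2_eq_2 numeral_3_eq_3)
  qed (use n in auto)
  then have h_neg: "psi n h < 0"
    using psi_sym[OF _ h_sym] n mean_h by simp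
  have mean_p: "binom_mean n p = sqrt (2 ^ (n - 1)) / 2 ^ (n - 1)"
  proof -
    have "(\<Sum>k = 0..n - 1. real ((n - 1) choose k) * p (k + 1)) = (\<Sum>k\<in>{0, n - 1}. real ((n - 1) choose k) * p (k + 1))"
      using n by (intro sum.mono_neutral_right) (auto simp: p_def)
    then show ?thesis using n by (simp add: binom_mean_def p_def)
  qed
  have "(\<Sum>k = 0..n - 2. real ((n - 2) choose k) * ((p (k + 2))\<^sup>2 + p (k + 1) * p (n - (k + 1))))
      = (\<Sum>k\<in>{n - 2}. real ((n - 2) choose k) * ((p (k + 2))\<^sup>2 + p (k + 1) * p (n - (k + 1))))"
    using n by (intro sum.mono_neutral_right) (auto simp: p_def)
  also have "\<dots> = 1" using n by (simp add: p_def)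
  finally have "psi n p = (binom_mean n p)\<^sup>2 - 1 / 2 ^ (n - 1)"
    by (simp add: psi_def binom_mean_def)
  then have psi_p: "psi n p = 0"
    unfolding mean_p by (simp add: power_divide) (simp add: power2_eq_square)
  have "(2::real) ^ 2 < 2 ^ (n - 1)" using n by (intro power_strict_increasing) auto
  then have "2 < sqrt (2 ^ (n - 1))" by (intro real_less_rsqrt)
  then have "nonsym n p" using n by (auto simp: nonsym_def p_def intro!: bexI[of _ 1])
  then have "p \<in> asym_cone n" using psi_p by (simp add: asym_cone_def)
  moreover have "psi_polar n p h = 0"
  proof -
    \<comment> \<open>Among the products \<open>p i * h (n - i)\<close>, the index
      \<open>i = n\<close> leads to \<open>h 0\<close> and \<open>i = 1\<close> to
      \<open>h (n - 1)\<close>; both vanish. The product of means vanishes since \<open>h\<close>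
      has mean zero.\<close>
    have h0: "h 0 = 0" "h 1 = 0" "h n = 0" "h (n - 1) = 0" using n by (auto simp: h_def)
    then have ph: "p i * h i = 0" "p i * h (n - i) = 0" for i by (auto simp: p_def)
    have "p (k + 2) * h (k + 2) + (p (k + 1) * h (n - (k + 1)) + h (k + 1) * p (n - (k + 1))) / 2 = 0"
      if "k \<in> {0..n - 2}" for k
    proof -
      have "n - (n - (k + 1)) = k + 1" using that n by auto
      then show ?thesis using ph(1)[of "k + 2"] ph(2)[of "k + 1"] ph(2)[of "n - (k + 1)"]
        by (simp only: mult.commute) simp
    qed
    then show ?thesis by (simp add: psi_polar_def mean_h cong: sum.cong_simp)
  qed
  ultimately show ?thesis
    using connected_asym_cone_aux[of n h p] n h_sym h_neg by simp
qed

section \<open>Passage from the cone to the cube\<close>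

lemma continuous_on_Max:
  fixes f :: "'i \<Rightarrow> 'a::topological_space \<Rightarrow> real"
  assumes "finite A" "A \<noteq> {}" "\<And>i. i \<in> A \<Longrightarrow> continuous_on S (f i)"
  shows "continuous_on S (\<lambda>x. Max ((\<lambda>i. f i x) ` A))"
  using assms
proof (induction A rule: finite_ne_induct)
  case (insert i A)
  then have "(\<lambda>x. Max ((\<lambda>i. f i x) ` insert i A)) = (\<lambda>x. max (f i x) (Max ((\<lambda>i. f i x) ` A)))"
    by (simp add: fun_eq_iff)
  then show ?case using insert by (auto intro!: continuous_on_max)
qed simp

lemma psi_cong:
  assumes "2 \<le> n" "\<And>i. i \<in> {1..n} \<Longrightarrow> p i = q i"
  shows "psi n p = psi n q"
proof -
  have "(\<Sum>k = 0..n - 1. real ((n - 1) choose k) * p (k + 1)) = (\<Sum>k = 0..n - 1. real ((n - 1) choose k) * q (k + 1))"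
    using assms by (intro sum.cong) auto
  moreover have "(\<Sum>k = 0..n - 2. real ((n - 2) choose k) * ((p (k + 2))\<^sup>2 + p (k + 1) * p (n - (k + 1))))
    = (\<Sum>k = 0..n - 2. real ((n - 2) choose k) * ((q (k + 2))\<^sup>2 + q (k + 1) * q (n - (k + 1))))"
    using assms by (intro sum.cong) auto
  ultimately show ?thesis by (simp add: psi_def)
qed

lemma nonsym_cong:
  assumes "\<And>i. i \<in> {1..n} \<Longrightarrow> p i = q i"
  shows "nonsym n p = nonsym n q"
proof -
  have "p k = q k" "p (n + 1 - k) = q (n + 1 - k)" if "k \<in> {1..n}" for k
    using assms[of k] assms[of "n + 1 - k"] that by (auto simp: Suc_le_eq Suc_diff_le)
  then show ?thesis by (simp add: nonsym_def)
qed

text \<open>Both conditions on \<open>p\<close> are invariant under the homotheties centred at \<open>(1/2, \<dots>, 1/2)\<close>.\<close>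

lemma connected_GST:
  assumes n: "8 \<le> n"
  shows "connected_space (GST_topology n)"
proof -
  \<comment> \<open>The maximum with 1 avoids division by zero and makes the scale constant on
    \<open>[-1, 1]^n\<close>, where \<open>g\<close> is affine in the coordinates of
    \<open>{1..n}\<close> and reaches all of the cube.\<close>
  define s where "s p = max 1 (Max ((\<lambda>i. \<bar>p i\<bar>) ` {1..n}))" for p :: "nat \<Rightarrow> real"
  define g where "g p = (\<lambda>i\<in>{1..n}. 1 / 2 + 1 / (2 * s p) * p i)" for p :: "nat \<Rightarrow> real"
  have s1: "1 \<le> s p" for p by (simp add: s_def)
  have s0: "s p \<noteq> 0" for p using s1[of p] by auto
  have sp: "\<bar>p i\<bar> \<le> s p" if "i \<in> {1..n}" for p i
    using that by (auto simp: s_def intro!: max.coboundedI2 Max_ge)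
  have g_ext: "g p \<in> {1..n} \<rightarrow>\<^sub>E {0..1}" for p
  proof
    fix i assume i: "i \<in> {1..n}"
    have "\<bar>p i / s p\<bar> \<le> 1" using sp[OF i, of p] s1[of p] by (simp add: divide_le_eq)
    moreover define z where "z = p i / s p"
    moreover have "g p i = 1 / 2 + z / 2" using i by (simp add: g_def z_def)
    ultimately show "g p i \<in> {0..1}" unfolding atLeastAtMost_iff by linarith
  qed (auto simp: g_def)
  have psi_g: "psi n (g p) = (1 / (2 * s p))\<^sup>2 * psi n p" for p
    using psi_cong[of n "g p" "\<lambda>i. 1 / 2 + 1 / (2 * s p) * p i"] psi_shift[of n "1 / 2" "1 / (2 * s p)" p] n
    by (simp add: g_def)
  have nonsym_g: "nonsym n (g p) \<longleftrightarrow> nonsym n p" for p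
  proof -
    have "nonsym n (g p) \<longleftrightarrow> nonsym n (\<lambda>i. 1 / 2 + 1 / (2 * s p) * p i)"
      by (rule nonsym_cong) (simp add: g_def)
    then show ?thesis using s1[of p] by (simp add: nonsym_def)
  qed
  have "g ` asym_cone n = GST n"
  proof (intro set_eqI iffI)
    fix q assume "q \<in> g ` asym_cone n"
    then show "q \<in> GST n"
      using g_ext psi_g nonsym_g n by (auto simp: GST_iff asym_cone_def)
  next
    fix q assume q: "q \<in> GST n"
    define p where "p i = - 1 + 2 * q i" for i
    have "\<bar>p i\<bar> \<le> 1" if "i \<in> {1..n}" for i
    proof -
      have "q i \<in> {0..1}" using q that n by (auto simp: GST_iff)
      then show ?thesis by (auto simp: p_def)
    qed
    then have "Max ((\<lambda>i. \<bar>p i\<bar>) ` {1..n}) \<le> 1"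
      using n by (subst Max_le_iff) auto
    then have "s p = 1" unfolding s_def by (rule max_absorb1)
    then have gp: "g p = q"
      using q n by (auto simp: g_def p_def GST_iff fun_eq_iff PiE_iff extensional_def field_simps)
    then have "p \<in> asym_cone n"
      using q psi_g[of p] nonsym_g[of p] n s1[of p] by (auto simp: asym_cone_def GST_iff)
    then show "q \<in> g ` asym_cone n" using gp by blast
  qed
  moreover have "continuous_map euclidean (powertop_real {1..n}) g"
  proof -
    have "continuous_on UNIV s"
      unfolding s_def using n
      by (intro continuous_on_max continuous_on_const continuous_on_Max continuous_on_rabs
          continuous_on_product_coordinates) auto
    then have "continuous_on UNIV (\<lambda>p. 1 / 2 + 1 / (2 * s p) * p i)" for i
      by (intro continuous_on_add continuous_on_mult continuous_on_divide continuous_on_const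
          continuous_on_product_coordinates) (use s0 in auto)
    then show ?thesis
      by (auto simp: continuous_map_componentwise g_def)
  qed
  ultimately have "connectedin (powertop_real {1..n}) (GST n)"
    using connectedin_continuous_map_image[of euclidean _ g "asym_cone n"] connected_asym_cone[OF n] by auto
  then show ?thesis by (simp add: GST_topology_def connectedin_def)
qed

theorem corollary7p4:
  "(\<forall>n\<in>{3, 4}. \<not> connected_space (GST_topology n)) \<and>
   (\<forall>n\<ge>8. connected_space (GST_topology n))"
  using not_connected_GST_3 not_connected_GST_4 connected_GST by blast

end
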